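(* Let $\Sigma$ be a finite alphabet and let $\rho>0$. For every $S\in\Sigma^*$ there exists $\delta(S,\rho)>0$ such that for all $T\in\Sigma^*$, $T\ne S$ implies $d_\rho(S,T)\ge\delta(S,\rho)$. In particular, the metric space $(\Sigma^*,d_\rho)$ has the discrete topology: for each $S$ the open ball of radius $\delta(S,\rho)/2$ centered at $S$ equals $\{S\}$.
   Context: $\Sigma$ is a finite set of characters; $\Sigma^n$ is the set of strings of length $n$ over $\Sigma$, and $\Sigma^*=\bigsqcup_{n\ge 0}\Sigma^n$. For strings $S,Q$, the multiplicity $c(S,Q)$ is the number of pairs $(P_1,P_2)$ of strings with $S=P_1QP_2$. For $n\ge 1$, $[S]_n\in\mathbb{R}^{\Sigma^n}$ is the $n$-gram count vector $[S]_n(X)=c(S,X)$ for $X\in\Sigma^n$. For vectors $u,v$ with nonnegative entries, $\theta(u,v)=\arccos\left(\frac{u\cdot v}{\|u\|\|v\|}\right)$ if $u,v\ne 0$, $\theta(u,v)=0$ if $u=v=0$, and $\theta(u,v)=\pi/2$ if exactly one of $u,v$ is $0$. Set $\theta_n(S,T)=\theta([S]_n,[T]_n)$ and $d_\rho(S,T)=\sum_{n\ge 1}\rho^n\theta_n(S,T)$ (a finite sum, since $\theta_n(S,T)=0$ for $n>\max(|S|,|T|)$); $d_\rho$ is a metric on $\Sigma^*$. *)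

theory Defs
  imports "HOL-Analysis.Analysis"
begin

definition strings_of_length :: "'a set \<Rightarrow> nat \<Rightarrow> 'a list set" where
  "strings_of_length \<Sigma> n = {X \<in> lists \<Sigma>. length X = n}"

definition multiplicity_in :: "'a list \<Rightarrow> 'a list \<Rightarrow> nat" where
  "multiplicity_in S Q = card {(P1, P2). S = P1 @ Q @ P2}"

text \<open>
  The length of the strings is determined by the index set, so one function represents all the
  count vectors of a string \<open>S\<close>: the \<open>n\<close>-gram count vector is its restriction to the strings
  of length \<open>n\<close>.
\<close>

definition gram_count :: "'a list \<Rightarrow> 'a list \<Rightarrow> real" where
  "gram_count S X = real (multiplicity_in S X)"

text \<open>
  A vector indexed by a finite set \<open>I\<close> is a function of which only the values on \<open>I\<close> matter.
  Its Euclidean norm is \<^term>\<open>L2_set u I\<close>.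
\<close>

definition vec_angle :: "'i set \<Rightarrow> ('i \<Rightarrow> real) \<Rightarrow> ('i \<Rightarrow> real) \<Rightarrow> real" where
  "vec_angle I u v =
    (if (\<forall>i\<in>I. u i = 0) \<and> (\<forall>i\<in>I. v i = 0) then 0
     else if (\<forall>i\<in>I. u i = 0) \<or> (\<forall>i\<in>I. v i = 0) then pi / 2
     else arccos ((\<Sum>i\<in>I. u i * v i) / (L2_set u I * L2_set v I)))"

definition gram_angle :: "'a set \<Rightarrow> nat \<Rightarrow> 'a list \<Rightarrow> 'a list \<Rightarrow> real" where
  "gram_angle \<Sigma> n S T = vec_angle (strings_of_length \<Sigma> n) (gram_count S) (gram_count T)"

definition gram_dist :: "'a set \<Rightarrow> real \<Rightarrow> 'a list \<Rightarrow> 'a list \<Rightarrow> real" where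
  "gram_dist \<Sigma> \<rho> S T = (\<Sum>\<^sub>\<infinity>n\<in>{1..}. \<rho> ^ n * gram_angle \<Sigma> n S T)"

lemma gram_count_eq_0: "length X > length S \<Longrightarrow> gram_count S X = 0"
proof -
  assume "length X > length S"
  then have "{(P1, P2). S = P1 @ X @ P2} = {}"
    by auto
  then show "gram_count S X = 0"
    by (simp only: gram_count_def multiplicity_in_def card.empty of_nat_0)
qed

lemma gram_angle_eq_0: "n > max (length S) (length T) \<Longrightarrow> gram_angle \<Sigma> n S T = 0"
  by (auto simp: gram_angle_def vec_angle_def strings_of_length_def gram_count_eq_0)

lemma gram_dist_finite_sum:
  "gram_dist \<Sigma> \<rho> S T = (\<Sum>n=1..max (length S) (length T). \<rho> ^ n * gram_angle \<Sigma> n S T)"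
proof -
  have "gram_dist \<Sigma> \<rho> S T =
      (\<Sum>\<^sub>\<infinity>n\<in>{1..max (length S) (length T)}. \<rho> ^ n * gram_angle \<Sigma> n S T)"
    unfolding gram_dist_def
    by (rule infsum_cong_neutral) (auto intro!: gram_angle_eq_0)
  then show ?thesis
    by simp
qed

end

theory Submission
  imports Defs
begin

text \<open>
  The metric axioms reduce to those of the angle between vectors, the only substantial one being
  the triangle inequality \<open>vec_angle_triangle\<close>, which is the spherical triangle inequality
  together with a discussion of zero vectors.

  Separation and discreteness come from one observation: for every \<open>S\<close> it suffices to look at
  the lengths \<open>|S|\<close> and \<open>|S| + 1\<close>. If \<open>T\<close> is longer than \<open>S\<close>, then at length \<open>|S| + 1\<close> the
  vector of \<open>S\<close> vanishes and that of \<open>T\<close> does not. If \<open>T\<close> is not longer than \<open>S\<close> and differs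
  from it, then at length \<open>|S|\<close> the vector of \<open>S\<close> is supported on \<open>S\<close> alone, a string that does
  not occur in \<open>T\<close>. Either way the two vectors are orthogonal and not both zero, so their
  angle is \<open>pi / 2\<close>. Hence the distance from \<open>S\<close> to any other string is at least
  \<open>pi / 2\<close> times the smaller of \<open>\<rho> ^ |S|\<close> and \<open>\<rho> ^ (|S| + 1)\<close>, whatever \<open>T\<close> is.
\<close>

section \<open>Angles between vectors with finitely many coordinates\<close>

lemma abs_sum_mult_le_L2_set: "\<bar>\<Sum>i\<in>I. f i * g i\<bar> \<le> L2_set f I * L2_set g I"
proof -
  have "\<bar>\<Sum>i\<in>I. f i * g i\<bar> \<le> (\<Sum>i\<in>I. \<bar>f i\<bar> * \<bar>g i\<bar>)"
    using sum_abs[of "\<lambda>i. f i * g i" I] by (simp add: abs_mult)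
  also have "\<dots> \<le> L2_set f I * L2_set g I"
    by (rule L2_set_mult_ineq)
  finally show ?thesis .
qed

text \<open>
  The components of the unit vectors \<open>u\<close> and \<open>w\<close> orthogonal to \<open>v\<close> have lengths \<open>sin \<alpha>\<close> and
  \<open>sin \<beta>\<close>, where \<open>\<alpha>\<close> and \<open>\<beta>\<close> are the angles of \<open>u\<close> and \<open>w\<close> with \<open>v\<close>. Cauchy--Schwarz for these components says
  that the inner product of \<open>u\<close> and \<open>w\<close> is at least
  \<open>cos \<alpha> * cos \<beta> - sin \<alpha> * sin \<beta> = cos (\<alpha> + \<beta>)\<close>. As \<open>cos\<close> decreases only up to \<open>pi\<close>, this
  settles the case \<open>\<alpha> + \<beta> \<le> pi\<close>; otherwise the right-hand side exceeds every value of \<open>arccos\<close>.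
\<close>

lemma arccos_inner_triangle:
  fixes u v w :: "'i \<Rightarrow> real"
  assumes unit: "(\<Sum>i\<in>I. (u i)\<^sup>2) = 1" "(\<Sum>i\<in>I. (v i)\<^sup>2) = 1" "(\<Sum>i\<in>I. (w i)\<^sup>2) = 1"
  shows "arccos (\<Sum>i\<in>I. u i * w i) \<le> arccos (\<Sum>i\<in>I. u i * v i) + arccos (\<Sum>i\<in>I. v i * w i)"
proof -
  define a b c where "a = (\<Sum>i\<in>I. u i * v i)" and "b = (\<Sum>i\<in>I. v i * w i)"
    and "c = (\<Sum>i\<in>I. u i * w i)"
  have a: "\<bar>a\<bar> \<le> 1" and b: "\<bar>b\<bar> \<le> 1" and c: "\<bar>c\<bar> \<le> 1"
    using abs_sum_mult_le_L2_set[of u v I] abs_sum_mult_le_L2_set[of v w I]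
      abs_sum_mult_le_L2_set[of u w I] unit by (simp_all add: a_def b_def c_def L2_set_def)
  have "(\<Sum>i\<in>I. (u i - a * v i)\<^sup>2)
      = (\<Sum>i\<in>I. (u i)\<^sup>2) - 2 * a * (\<Sum>i\<in>I. u i * v i) + a\<^sup>2 * (\<Sum>i\<in>I. (v i)\<^sup>2)"
    by (simp add: power2_eq_square algebra_simps sum.distrib sum_subtractf sum_distrib_left)
  then have nu: "(\<Sum>i\<in>I. (u i - a * v i)\<^sup>2) = 1 - a\<^sup>2"
    using unit by (simp add: a_def[symmetric] power2_eq_square)
  have "(\<Sum>i\<in>I. (w i - b * v i)\<^sup>2)
      = (\<Sum>i\<in>I. (w i)\<^sup>2) - 2 * b * (\<Sum>i\<in>I. v i * w i) + b\<^sup>2 * (\<Sum>i\<in>I. (v i)\<^sup>2)"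
    by (simp add: power2_eq_square algebra_simps sum.distrib sum_subtractf sum_distrib_left)
  then have nw: "(\<Sum>i\<in>I. (w i - b * v i)\<^sup>2) = 1 - b\<^sup>2"
    using unit by (simp add: b_def[symmetric] power2_eq_square)
  have "(\<Sum>i\<in>I. (u i - a * v i) * (w i - b * v i))
      = (\<Sum>i\<in>I. u i * w i) - b * (\<Sum>i\<in>I. u i * v i) - a * (\<Sum>i\<in>I. v i * w i)
        + a * b * (\<Sum>i\<in>I. (v i)\<^sup>2)"
    by (simp add: power2_eq_square algebra_simps sum.distrib sum_subtractf sum_distrib_left)
  then have "(\<Sum>i\<in>I. (u i - a * v i) * (w i - b * v i)) = c - a * b"
    using unit by (simp add: a_def[symmetric] b_def[symmetric] c_def[symmetric])
  then have "\<bar>c - a * b\<bar> \<le> sqrt (1 - a\<^sup>2) * sqrt (1 - b\<^sup>2)"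
    using abs_sum_mult_le_L2_set[of "\<lambda>i. u i - a * v i" "\<lambda>i. w i - b * v i" I]
    by (simp add: L2_set_def nu nw)
  then have "cos (arccos a + arccos b) \<le> c"
    using a b by (simp add: cos_add sin_arccos_abs abs_le_iff)
  show ?thesis
  proof (cases "arccos a + arccos b \<le> pi")
    case True
    have "0 \<le> arccos a + arccos b"
      using a b by (intro add_nonneg_nonneg arccos_lbound) auto
    then have "arccos a + arccos b = arccos (cos (arccos a + arccos b))"
      using True by (simp add: arccos_cos)
    also have "\<dots> \<ge> arccos c"
      using \<open>cos (arccos a + arccos b) \<le> c\<close> c by (intro arccos_le_arccos) auto
    finally show ?thesis
      by (simp add: a_def b_def c_def)
  next
    case False
    then show ?thesis
      using arccos_ubound[of c] c by (simp add: a_def b_def c_def abs_le_iff)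
  qed
qed

lemma vec_angle_commute: "vec_angle I u v = vec_angle I v u"
  unfolding vec_angle_def by (simp add: mult.commute conj_commute disj_commute)

lemma L2_set_pos:
  assumes "finite I" "\<not> (\<forall>i\<in>I. u i = 0)"
  shows "L2_set u I > 0"
  using assms L2_set_nonneg[of u I] L2_set_eq_0_iff[of I u] by linarith

lemma vec_angle_self:
  assumes "finite I"
  shows "vec_angle I u u = 0"
proof (cases "\<forall>i\<in>I. u i = 0")
  case False
  have "(\<Sum>i\<in>I. u i * u i) = L2_set u I * L2_set u I"
    by (simp add: L2_set_def sum_nonneg power2_eq_square)
  then show ?thesis
    using False L2_set_pos[OF assms False] by (auto simp: vec_angle_def)
qed (simp add: vec_angle_def)

lemma vec_angle_orthogonal:
  assumes "(\<Sum>i\<in>I. u i * v i) = 0" and "\<not> ((\<forall>i\<in>I. u i = 0) \<and> (\<forall>i\<in>I. v i = 0))"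
  shows "vec_angle I u v = pi / 2"
  unfolding vec_angle_def if_not_P[OF assms(2)] assms(1) by simp

lemma vec_angle_bounds: "0 \<le> vec_angle I u v" "vec_angle I u v \<le> pi"
proof -
  define q where "q = (\<Sum>i\<in>I. u i * v i) / (L2_set u I * L2_set v I)"
  have "\<bar>q\<bar> = \<bar>\<Sum>i\<in>I. u i * v i\<bar> / (L2_set u I * L2_set v I)"
    by (simp add: q_def abs_mult)
  then have "\<bar>q\<bar> \<le> 1"
    using abs_sum_mult_le_L2_set[of u v I] mult_nonneg_nonneg[OF L2_set_nonneg L2_set_nonneg, of u I v I]
    by (metis divide_le_eq_1 less_le)
  then have "0 \<le> arccos q" "arccos q \<le> pi"
    using arccos_lbound[of q] arccos_ubound[of q] by (simp_all add: abs_le_iff)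
  then show "0 \<le> vec_angle I u v" "vec_angle I u v \<le> pi"
    using pi_gt_zero by (auto simp: vec_angle_def q_def)
qed

text \<open>
  A zero vector is at angle \<open>pi / 2\<close> from every nonzero one, so when some of the vectors
  vanish the inequality needs only that angles lie between \<open>0\<close> and \<open>pi\<close>; the bound \<open>pi\<close> is
  used when \<open>v\<close> alone is zero. Otherwise all three vectors are scaled to unit length.
\<close>

lemma vec_angle_triangle:
  assumes "finite I"
  shows "vec_angle I u w \<le> vec_angle I u v + vec_angle I v w"
proof (cases "(\<forall>i\<in>I. u i = 0) \<or> (\<forall>i\<in>I. v i = 0) \<or> (\<forall>i\<in>I. w i = 0)")
  case True
  define Z :: "('a \<Rightarrow> real) \<Rightarrow> bool" where "Z f \<longleftrightarrow> (\<forall>i\<in>I. f i = 0)" for f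
  have zero: "vec_angle I f g = (if Z g then 0 else pi / 2)" if "Z f" for f g
    using that by (simp add: vec_angle_def Z_def)
  have zero': "vec_angle I f g = (if Z f then 0 else pi / 2)" if "Z g" for f g
    using zero[OF that] by (simp add: vec_angle_commute)
  have "Z u \<or> Z v \<or> Z w"
    using True by (simp add: Z_def)
  then show ?thesis
    using vec_angle_bounds[of I u v] vec_angle_bounds[of I v w] vec_angle_bounds[of I u w]
    by (cases "Z u"; cases "Z v"; cases "Z w") (simp_all add: zero zero')
next
  case False
  define unit :: "('a \<Rightarrow> real) \<Rightarrow> 'a \<Rightarrow> real" where "unit f i = f i / L2_set f I" for f i
  have norm: "(\<Sum>i\<in>I. (unit f i)\<^sup>2) = 1" if "\<not> (\<forall>i\<in>I. f i = 0)" for f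
  proof -
    have "(\<Sum>i\<in>I. (unit f i)\<^sup>2) = (\<Sum>i\<in>I. (f i)\<^sup>2) / (L2_set f I)\<^sup>2"
      by (simp add: unit_def power_divide sum_divide_distrib)
    also have "(\<Sum>i\<in>I. (f i)\<^sup>2) = (L2_set f I)\<^sup>2"
      by (simp add: L2_set_def sum_nonneg)
    finally show ?thesis
      using L2_set_pos[OF \<open>finite I\<close> that] by simp
  qed
  have angle: "vec_angle I f g = arccos (\<Sum>i\<in>I. unit f i * unit g i)"
    if "\<not> (\<forall>i\<in>I. f i = 0)" "\<not> (\<forall>i\<in>I. g i = 0)" for f g
  proof -
    have "(\<Sum>i\<in>I. unit f i * unit g i) = (\<Sum>i\<in>I. f i * g i) / (L2_set f I * L2_set g I)"
      by (simp add: unit_def sum_divide_distrib)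
    then show ?thesis
      using that by (auto simp: vec_angle_def)
  qed
  show ?thesis
    using False by (simp only: angle norm de_Morgan_disj arccos_inner_triangle not_False_eq_True)
qed

section \<open>Occurrences of substrings\<close>

lemma finite_strings_of_length: "finite \<Sigma> \<Longrightarrow> finite (strings_of_length \<Sigma> n)"
  using finite_lists_length_eq[of \<Sigma> n] by (simp add: strings_of_length_def lists_eq_set)

text \<open>
  Multiplicities are cardinalities, and an infinite set would have cardinality zero; so
  occurrence gives a positive count only because a string has finitely many splittings.
\<close>

lemma gram_count_eq_0_iff: "gram_count S X = 0 \<longleftrightarrow> (\<nexists>P1 P2. S = P1 @ X @ P2)"
proof -
  have "{(P1, P2). S = P1 @ X @ P2}
      \<subseteq> (\<lambda>(i, j). (take i S, drop j S)) ` ({..length S} \<times> {..length S})"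
  proof
    fix P assume "P \<in> {(P1, P2). S = P1 @ X @ P2}"
    then show "P \<in> (\<lambda>(i, j). (take i S, drop j S)) ` ({..length S} \<times> {..length S})"
      by (intro image_eqI[of _ _ "(length (fst P), length (fst P) + length X)"]) auto
  qed
  then have "finite {(P1, P2). S = P1 @ X @ P2}"
    by (rule finite_subset) auto
  then show ?thesis
    by (auto simp: gram_count_def multiplicity_in_def)
qed

lemma gram_count_same_length:
  assumes "length X = length S"
  shows "gram_count S X = 0 \<longleftrightarrow> X \<noteq> S"
proof
  assume "gram_count S X = 0"
  moreover have "S = [] @ S @ []"
    by simp
  ultimately show "X \<noteq> S"
    unfolding gram_count_eq_0_iff by blast
qed (use assms in \<open>auto simp: gram_count_eq_0_iff\<close>)

section \<open>The distance between strings\<close>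

lemma gram_angle_nonneg: "0 \<le> gram_angle \<Sigma> n S T"
  unfolding gram_angle_def by (rule vec_angle_bounds)

lemma gram_angle_triangle:
  assumes "finite \<Sigma>"
  shows "gram_angle \<Sigma> n S U \<le> gram_angle \<Sigma> n S T + gram_angle \<Sigma> n T U"
  unfolding gram_angle_def
  by (intro vec_angle_triangle finite_strings_of_length assms)

lemma gram_angle_longer:
  assumes "T \<in> lists \<Sigma>" "length S < length T"
  shows "gram_angle \<Sigma> (Suc (length S)) S T = pi / 2"
  unfolding gram_angle_def
proof (rule vec_angle_orthogonal)
  let ?I = "strings_of_length \<Sigma> (Suc (length S))"
  let ?X = "take (Suc (length S)) T"
  show "(\<Sum>X\<in>?I. gram_count S X * gram_count T X) = 0"
    by (rule sum.neutral) (simp add: strings_of_length_def gram_count_eq_0)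
  have "?X \<in> ?I"
    using assms by (auto simp: strings_of_length_def dest: in_set_takeD)
  moreover have "T = [] @ ?X @ drop (Suc (length S)) T"
    by simp
  then have "gram_count T ?X \<noteq> 0"
    unfolding gram_count_eq_0_iff by blast
  ultimately show "\<not> ((\<forall>X\<in>?I. gram_count S X = 0) \<and> (\<forall>X\<in>?I. gram_count T X = 0))"
    by blast
qed

lemma gram_angle_not_longer:
  assumes "S \<in> lists \<Sigma>" "length T \<le> length S" "T \<noteq> S"
  shows "gram_angle \<Sigma> (length S) S T = pi / 2"
  unfolding gram_angle_def
proof (rule vec_angle_orthogonal)
  let ?I = "strings_of_length \<Sigma> (length S)"
  have "gram_count T S = 0"
    using assms gram_count_eq_0[of T S] gram_count_same_length[of S T]
    by (cases "length T = length S") auto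
  then show "(\<Sum>X\<in>?I. gram_count S X * gram_count T X) = 0"
    by (intro sum.neutral) (auto simp: strings_of_length_def gram_count_same_length)
  have "S \<in> ?I" "gram_count S S \<noteq> 0"
    using assms by (simp_all add: strings_of_length_def gram_count_same_length)
  then show "\<not> ((\<forall>X\<in>?I. gram_count S X = 0) \<and> (\<forall>X\<in>?I. gram_count T X = 0))"
    by blast
qed

lemma gram_dist_ge_term:
  assumes "\<rho> > 0" "1 \<le> n" "n \<le> max (length S) (length T)"
  shows "\<rho> ^ n * gram_angle \<Sigma> n S T \<le> gram_dist \<Sigma> \<rho> S T"
  unfolding gram_dist_finite_sum
  by (rule member_le_sum) (use assms gram_angle_nonneg[of \<Sigma> _ S T] in auto)

text \<open>
  A single orthogonal pair of count vectors already gives the bound, at length \<open>|S|\<close> or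
  \<open>|S| + 1\<close>. Which of the two it is depends on \<open>T\<close>, so the minimum is what makes the bound
  uniform in \<open>T\<close>.
\<close>

lemma gram_dist_lower_bound:
  assumes "\<rho> > 0" "S \<in> lists \<Sigma>" "T \<in> lists \<Sigma>" "T \<noteq> S"
  shows "min (\<rho> ^ length S) (\<rho> ^ Suc (length S)) * (pi / 2) \<le> gram_dist \<Sigma> \<rho> S T"
proof (cases "length S < length T")
  case True
  have "min (\<rho> ^ length S) (\<rho> ^ Suc (length S)) * (pi / 2) \<le> \<rho> ^ Suc (length S) * (pi / 2)"
    by (intro mult_right_mono) auto
  also have "\<dots> \<le> gram_dist \<Sigma> \<rho> S T"
    using gram_dist_ge_term[of \<rho> "Suc (length S)" S T \<Sigma>] gram_angle_longer[of T \<Sigma> S] assms True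
    by simp
  finally show ?thesis .
next
  case False
  \<comment> \<open>The sum starts at length one; the empty \<open>S\<close> is excluded, as no other \<open>T\<close> is as short.\<close>
  then have "1 \<le> length S"
    using assms(4) by (cases S) auto
  have "min (\<rho> ^ length S) (\<rho> ^ Suc (length S)) * (pi / 2) \<le> \<rho> ^ length S * (pi / 2)"
    by (intro mult_right_mono) auto
  also have "\<dots> \<le> gram_dist \<Sigma> \<rho> S T"
    using gram_dist_ge_term[of \<rho> "length S" S T \<Sigma>] gram_angle_not_longer[of S \<Sigma> T] assms False
      \<open>1 \<le> length S\<close> by simp
  finally show ?thesis .
qed

text \<open>
  The lengths that contribute depend on the pair of strings; beyond the longest of all three
  strings every angle is zero, so the three distances can be written as sums over one range.
\<close>

lemma gram_dist_sum_upto: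
  assumes "length S \<le> N" "length T \<le> N"
  shows "gram_dist \<Sigma> \<rho> S T = (\<Sum>n=1..N. \<rho> ^ n * gram_angle \<Sigma> n S T)"
  unfolding gram_dist_finite_sum
  by (rule sum.mono_neutral_left) (use assms in \<open>auto intro!: gram_angle_eq_0\<close>)

lemma Metric_space_gram_dist:
  assumes "finite \<Sigma>" "\<rho> > 0"
  shows "Metric_space (lists \<Sigma>) (gram_dist \<Sigma> \<rho>)"
proof
  fix S T U :: "'a list"
  show "0 \<le> gram_dist \<Sigma> \<rho> S T"
    unfolding gram_dist_finite_sum using assms
    by (intro sum_nonneg mult_nonneg_nonneg gram_angle_nonneg) auto
  show "gram_dist \<Sigma> \<rho> S T = gram_dist \<Sigma> \<rho> T S"
    unfolding gram_dist_def gram_angle_def by (simp add: vec_angle_commute)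
  show "gram_dist \<Sigma> \<rho> S T = 0 \<longleftrightarrow> S = T" if "S \<in> lists \<Sigma>" "T \<in> lists \<Sigma>"
  proof
    assume "S = T"
    then show "gram_dist \<Sigma> \<rho> S T = 0"
      using assms by (simp add: gram_dist_finite_sum gram_angle_def vec_angle_self
          finite_strings_of_length)
  next
    assume "gram_dist \<Sigma> \<rho> S T = 0"
    moreover have "0 < min (\<rho> ^ length S) (\<rho> ^ Suc (length S)) * (pi / 2)"
      using assms by simp
    ultimately show "S = T"
      using gram_dist_lower_bound[OF assms(2) that] by (metis not_less)
  qed
  show "gram_dist \<Sigma> \<rho> S U \<le> gram_dist \<Sigma> \<rho> S T + gram_dist \<Sigma> \<rho> T U"
  proof -
    define N where "N = Max {length S, length T, length U}"
    have "(\<Sum>n=1..N. \<rho> ^ n * gram_angle \<Sigma> n S U)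
        \<le> (\<Sum>n=1..N. \<rho> ^ n * (gram_angle \<Sigma> n S T + gram_angle \<Sigma> n T U))"
      using assms by (intro sum_mono mult_left_mono gram_angle_triangle) auto
    then show ?thesis
      by (simp add: gram_dist_sum_upto[of _ N] N_def distrib_left sum.distrib)
  qed
qed

theorem proposition7p9:
  fixes \<Sigma> :: "'a set" and \<rho> :: real
  assumes "finite \<Sigma>" and "\<rho> > 0"
  shows "Metric_space (lists \<Sigma>) (gram_dist \<Sigma> \<rho>)
    \<and> (\<forall>S \<in> lists \<Sigma>. \<exists>\<delta>>0.
          (\<forall>T \<in> lists \<Sigma>. T \<noteq> S \<longrightarrow> gram_dist \<Sigma> \<rho> S T \<ge> \<delta>)
        \<and> Metric_space.mball (lists \<Sigma>) (gram_dist \<Sigma> \<rho>) S (\<delta> / 2) = {S})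
    \<and> Metric_space.mtopology (lists \<Sigma>) (gram_dist \<Sigma> \<rho>) = discrete_topology (lists \<Sigma>)"
proof -
  interpret Metric_space "lists \<Sigma>" "gram_dist \<Sigma> \<rho>"
    using assms by (rule Metric_space_gram_dist)
  have isolated: "\<exists>\<delta>>0. (\<forall>T \<in> lists \<Sigma>. T \<noteq> S \<longrightarrow> gram_dist \<Sigma> \<rho> S T \<ge> \<delta>) \<and> mball S (\<delta> / 2) = {S}"
    if S: "S \<in> lists \<Sigma>" for S
  proof -
    define \<delta> where "\<delta> = min (\<rho> ^ length S) (\<rho> ^ Suc (length S)) * (pi / 2)"
    have "\<delta> > 0"
      using assms by (simp add: \<delta>_def)
    have far: "gram_dist \<Sigma> \<rho> S T \<ge> \<delta>" if "T \<in> lists \<Sigma>" "T \<noteq> S" for T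
      unfolding \<delta>_def using assms S that by (intro gram_dist_lower_bound)
    have "T = S" if "T \<in> mball S (\<delta> / 2)" for T
    proof (rule ccontr)
      assume "T \<noteq> S"
      then have "gram_dist \<Sigma> \<rho> S T \<ge> \<delta>" "gram_dist \<Sigma> \<rho> S T < \<delta> / 2"
        using far[of T] that unfolding in_mball by blast+
      then show False
        using \<open>\<delta> > 0\<close> by linarith
    qed
    moreover have "S \<in> mball S (\<delta> / 2)"
      using S \<open>\<delta> > 0\<close> by (simp del: in_lists_conv_set)
    ultimately have "mball S (\<delta> / 2) = {S}"
      by blast
    with \<open>\<delta> > 0\<close> far show ?thesis
      by blast
  qed
  have "openin mtopology {S}" if "S \<in> lists \<Sigma>" for S
    using isolated[OF that] openin_mball by metis
  then have "mtopology = discrete_topology (lists \<Sigma>)"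
    by (metis discrete_topology_unique topspace_mtopology)
  then show ?thesis
    using isolated Metric_space_axioms by blast
qed

end
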